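(* For each $n$ let $n_1=n_1(n)$ and $n_2=n_2(n)$ with $n_1+n_2=n$, let $\Lambda_1,\Lambda_2$ be disjoint sets of nodes with $|\Lambda_1|=n_1$, $|\Lambda_2|=n_2$, and let $\mathcal{G}_{n_1,n_2}$ be the set of all bi-partite graphs with layers $\Lambda_1,\Lambda_2$. Let $L^*=L^*(n)$ be a value of the total number of links realised by at least one graph in $\mathcal{G}_{n_1,n_2}$, and consider the microcanonical and canonical ensembles $P_{\mathrm{mic}},P_{\mathrm{can}}$ on $\mathcal{G}_{n_1,n_2}$ with the single constraint $\vec{C}^*=L^*$ on the total number of links $L(\mathbf{G})$. Then $$s_\infty=\lim_{n\to\infty}\frac{S_{n_1+n_2}(P_{\mathrm{mic}}\mid P_{\mathrm{can}})}{n_1+n_2}=0.$$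
   Context: Graphs are simple and undirected, with adjacency entries $g_{i,j}(\mathbf{G})\in\{0,1\}$. A graph is bi-partite with layers $\Lambda_1,\Lambda_2$ if its node set is $\Lambda_1\cup\Lambda_2$ and $g_{i,j}(\mathbf{G})=0$ whenever $i,j\in\Lambda_1$ or $i,j\in\Lambda_2$. The total number of links is $L(\mathbf{G})=\sum_{i\in\Lambda_1}\sum_{j\in\Lambda_2}g_{i,j}(\mathbf{G})$. Ensembles: given a finite set $\mathcal{G}$ of graphs, a (vector-valued) function $\vec C$ on $\mathcal{G}$ and a value $\vec C^*$ attained by $\vec C$ for at least one graph in $\mathcal{G}$, the microcanonical distribution is $P_{\mathrm{mic}}(\mathbf{G})=1/\Omega_{\vec C^*}$ if $\vec C(\mathbf{G})=\vec C^*$ and $0$ otherwise, where $\Omega_{\vec C^*}=|\{\mathbf{G}\in\mathcal{G}\colon\vec C(\mathbf{G})=\vec C^*\}|$. The canonical distribution $P_{\mathrm{can}}$ is the probability distribution on $\mathcal{G}$ that maximises the entropy $-\sum_{\mathbf{G}\in\mathcal{G}}P(\mathbf{G})\ln P(\mathbf{G})$ subject to $\sum_{\mathbf{G}\in\mathcal{G}}P(\mathbf{G})\,\vec C(\mathbf{G})=\vec C^*$; it has the form $P_{\mathrm{can}}(\mathbf{G})=e^{-\vec\theta^*\cdot\vec C(\mathbf{G})}/Z(\vec\theta^* )$ with $Z(\vec\theta)=\sum_{\mathbf{G}\in\mathcal{G}}e^{-\vec\theta\cdot\vec C(\mathbf{G})}$ and $\vec\theta^*$ chosen such that the average of $\vec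 C$ equals $\vec C^*$. The relative entropy, with $n=n_1+n_2$ the number of nodes, is $S_n(P_{\mathrm{mic}}\mid P_{\mathrm{can}})=\sum_{\mathbf{G}\in\mathcal{G}}P_{\mathrm{mic}}(\mathbf{G})\ln\frac{P_{\mathrm{mic}}(\mathbf{G})}{P_{\mathrm{can}}(\mathbf{G})}$. *)

theory Defs
  imports "HOL-Probability.Probability" "Graph_Theory.Pair_Digraph"
begin

text \<open>
  Simple undirected graphs are represented as in \<open>Graph_Theory\<close>: a \<open>pair_graph\<close> has finitely many
  nodes and a symmetric, irreflexive arc relation on them. An undirected link between \<open>i\<close> and \<open>j\<close>
  therefore appears as the two arcs \<open>(i, j)\<close> and \<open>(j, i)\<close>.
\<close>

definition adj_entry :: "'a \<Rightarrow> 'a \<Rightarrow> 'a pair_pre_digraph \<Rightarrow> real" where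
  "adj_entry i j G = (if (i, j) \<in> parcs G then 1 else 0)"

definition bipartite_graph :: "'a set \<Rightarrow> 'a set \<Rightarrow> 'a pair_pre_digraph \<Rightarrow> bool" where
  "bipartite_graph \<Lambda>1 \<Lambda>2 G \<longleftrightarrow>
     pair_graph G \<and> pverts G = \<Lambda>1 \<union> \<Lambda>2 \<and>
     (\<forall>i j. (i \<in> \<Lambda>1 \<and> j \<in> \<Lambda>1) \<or> (i \<in> \<Lambda>2 \<and> j \<in> \<Lambda>2) \<longrightarrow> adj_entry i j G = 0)"

definition bipartite_graphs :: "'a set \<Rightarrow> 'a set \<Rightarrow> 'a pair_pre_digraph set" where
  "bipartite_graphs \<Lambda>1 \<Lambda>2 = {G. bipartite_graph \<Lambda>1 \<Lambda>2 G}"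

definition total_links :: "'a set \<Rightarrow> 'a set \<Rightarrow> 'a pair_pre_digraph \<Rightarrow> real" where
  "total_links \<Lambda>1 \<Lambda>2 G = (\<Sum>i\<in>\<Lambda>1. \<Sum>j\<in>\<Lambda>2. adj_entry i j G)"

text \<open>
  Ensembles on a finite set \<open>\<G>\<close>, for a constraint function \<open>C\<close> and a value \<open>c\<close> that \<open>C\<close> attains
  on \<open>\<G>\<close>; without these two assumptions the values of \<open>microcanonical\<close> and \<open>canonical\<close> carry no
  meaning.
\<close>

definition microcanonical :: "'g set \<Rightarrow> ('g \<Rightarrow> 'v) \<Rightarrow> 'v \<Rightarrow> 'g pmf" where
  "microcanonical \<G> C c = pmf_of_set {G \<in> \<G>. C G = c}"

text \<open>The convention \<open>0 * ln 0 = 0\<close> holds automatically, since \<open>ln 0 = 0\<close> in HOL.\<close>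

definition entropy_on :: "'g set \<Rightarrow> 'g pmf \<Rightarrow> real" where
  "entropy_on \<G> p = - (\<Sum>G\<in>\<G>. pmf p G * ln (pmf p G))"

text \<open>
  The canonical ensemble is the entropy maximiser itself. It has the exponential form
  \<open>exp (- (\<theta> \<bullet> C G)) / Z \<theta>\<close> only if \<open>c\<close> is not an extreme value of the constraint: for
  \<open>c\<close> equal to the minimum or the maximum of a real-valued non-constant \<open>C\<close> no finite \<open>\<theta>\<close> exists,
  whereas the maximiser still does.
\<close>

definition canonical :: "'g set \<Rightarrow> ('g \<Rightarrow> 'v::real_vector) \<Rightarrow> 'v \<Rightarrow> 'g pmf" where
  "canonical \<G> C c =
     (ARG_MAX (entropy_on \<G>) p. set_pmf p \<subseteq> \<G> \<and> (\<Sum>G\<in>\<G>. pmf p G *\<^sub>R C G) = c)"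

text \<open>
  Extended-real valued, because over the reals \<open>ln (x / 0) = 0\<close> would hide a failure of absolute
  continuity.
\<close>

definition relative_entropy :: "'g set \<Rightarrow> 'g pmf \<Rightarrow> 'g pmf \<Rightarrow> ereal" where
  "relative_entropy \<G> p q =
     (\<Sum>G\<in>\<G>. if pmf p G = 0 then 0
           else if pmf q G = 0 then \<infinity>
           else ereal (pmf p G * ln (pmf p G / pmf q G)))"

end

theory Submission
  imports Defs "HOL-Real_Asymp.Real_Asymp"
begin

text \<open>
  The canonical ensemble is the product measure in which each of the \<open>N = n1 * n2\<close> possible links is
  present independently with probability \<open>L* / N\<close>: its log-density is affine in the number of
  links, so by Gibbs' inequality it is the unique entropy maximiser. Hence the relative
  entropy equals \<open>- ln b\<close>, where \<open>b\<close> is the probability that a binomial variable with parameters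
  \<open>N\<close> and \<open>L* / N\<close> equals its mean \<open>L*\<close>. The mean is also the mode, so
  \<open>1 / (N + 1) \<le> b \<le> 1\<close>, and the relative entropy is at most \<open>ln (n\<^sup>2 + 1)\<close>.
\<close>

section \<open>Gibbs' inequality and entropy maximisers\<close>

text \<open>For \<open>x \<noteq> 0\<close> this is \<open>ln t \<le> t - 1\<close> at
  \<open>t = y / x\<close>, multiplied by \<open>x\<close>; equality there forces
  \<open>t = 1\<close>. For \<open>x = 0\<close> the left side vanishes.\<close>

lemma Gibbs_pointwise:
  fixes x y :: real
  assumes "0 \<le> x" "0 \<le> y" "x \<noteq> 0 \<Longrightarrow> y \<noteq> 0"
  shows "x * ln y - x * ln x \<le> y - x"
    and "x * ln y - x * ln x = y - x \<Longrightarrow> x = y"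
proof -
  have *: "x * ln y - x * ln x = x * ln (y / x)" "y - x = x * (y / x - 1)" "0 < y / x" if "x \<noteq> 0"
    using that assms by (auto simp: ln_div right_diff_distrib)
  show "x * ln y - x * ln x \<le> y - x"
    using assms * ln_le_minus_one[of "y / x"] by (cases "x = 0") (simp_all add: mult_left_mono)
  show "x = y" if "x * ln y - x * ln x = y - x"
  proof (cases "x = 0")
    case False
    with that * have "ln (y / x) = y / x - 1" by (metis mult_cancel_left)
    then have "y / x = 1" using ln_eq_minus_one * False by blast
    then show ?thesis by simp
  qed (use that in auto)
qed

text \<open>The pointwise bounds are summed; their right sides cancel because both masses total 1.
  The inclusion of supports matters: where \<open>q\<close> vanishes but \<open>p\<close> does not,
  \<open>ln 0 = 0\<close> would replace an infinite cross term by 0.\<close>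

lemma Gibbs_entropy:
  assumes "finite \<G>" and pq: "set_pmf p \<subseteq> set_pmf q" and q: "set_pmf q \<subseteq> \<G>"
  shows "entropy_on \<G> p \<le> - (\<Sum>G\<in>\<G>. pmf p G * ln (pmf q G))"
    and "entropy_on \<G> p = - (\<Sum>G\<in>\<G>. pmf p G * ln (pmf q G)) \<Longrightarrow> p = q"
proof -
  define d where "d G = pmf p G * ln (pmf q G) - pmf p G * ln (pmf p G)" for G
  have ac: "pmf p G \<noteq> 0 \<Longrightarrow> pmf q G \<noteq> 0" for G
    using pq by (auto simp flip: set_pmf_iff)
  have d_le: "d G \<le> pmf q G - pmf p G" for G
    unfolding d_def by (rule Gibbs_pointwise(1)) (use ac in auto)
  have d_eq: "pmf p G = pmf q G" if "d G = pmf q G - pmf p G" for G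
    by (rule Gibbs_pointwise(2)) (use ac that in \<open>auto simp: d_def\<close>)
  have sums: "(\<Sum>G\<in>\<G>. pmf q G - pmf p G) = 0"
    using assms by (simp add: sum_subtractf sum_pmf_eq_1)
  have sum_d: "sum d \<G> = entropy_on \<G> p + (\<Sum>G\<in>\<G>. pmf p G * ln (pmf q G))"
    by (simp add: d_def entropy_on_def sum_subtractf)
  have "sum d \<G> \<le> 0" using sum_mono[of \<G> d "\<lambda>G. pmf q G - pmf p G"] d_le sums by simp
  then show "entropy_on \<G> p \<le> - (\<Sum>G\<in>\<G>. pmf p G * ln (pmf q G))" using sum_d by simp
  assume "entropy_on \<G> p = - (\<Sum>G\<in>\<G>. pmf p G * ln (pmf q G))"
  then have "(\<Sum>G\<in>\<G>. (pmf q G - pmf p G) - d G) = 0"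
    using sum_d sums by (simp add: sum_subtractf)
  then have "\<forall>G\<in>\<G>. (pmf q G - pmf p G) - d G = 0"
    using d_le by (subst (asm) sum_nonneg_eq_0_iff) (auto simp: assms(1))
  then have on: "pmf p G = pmf q G" if "G \<in> \<G>" for G using d_eq that by simp
  have off: "pmf p G = pmf q G" if "G \<notin> \<G>" for G
    using that pq q by (metis pmf_eq_0_set_pmf subset_iff)
  show "p = q" by (rule pmf_eqI) (use on off in blast)
qed

text \<open>If every feasible \<open>p\<close> has the same cross-entropy \<open>- a\<close> against
  \<open>q\<close>, Gibbs' inequality bounds all feasible entropies by \<open>- a\<close>, and only
  \<open>q\<close> attains it. This uniqueness determines the value of the choice operator behind
  \<open>ARG_MAX\<close>.\<close>

lemma canonical_eqI:
  fixes C :: "'g \<Rightarrow> 'v::real_vector"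
  defines "feasible \<equiv> \<lambda>\<G> c p. set_pmf p \<subseteq> \<G> \<and> (\<Sum>G\<in>\<G>. pmf p G *\<^sub>R C G) = c"
  assumes "finite \<G>" and q: "feasible \<G> c q"
    and ac: "\<And>p. feasible \<G> c p \<Longrightarrow> set_pmf p \<subseteq> set_pmf q"
    and const: "\<And>p. feasible \<G> c p \<Longrightarrow> (\<Sum>G\<in>\<G>. pmf p G * ln (pmf q G)) = a"
  shows "canonical \<G> C c = q"
proof -
  have qG: "set_pmf q \<subseteq> \<G>" using q by (simp add: feasible_def)
  have Hq: "entropy_on \<G> q = - a" using const[OF q] by (simp add: entropy_on_def)
  have max: "is_arg_max (entropy_on \<G>) (feasible \<G> c) q"
    unfolding is_arg_max_def
    using q Gibbs_entropy(1)[OF \<open>finite \<G>\<close> ac qG] const Hq by (metis leD)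
  have unique: "p = q" if "is_arg_max (entropy_on \<G>) (feasible \<G> c) p" for p
  proof -
    have p: "feasible \<G> c p" and "\<not> entropy_on \<G> q > entropy_on \<G> p"
      using that q by (auto simp: is_arg_max_def)
    then have "entropy_on \<G> p = - (\<Sum>G\<in>\<G>. pmf p G * ln (pmf q G))"
      using Gibbs_entropy(1)[OF \<open>finite \<G>\<close> ac[OF p] qG] const[OF p] Hq by simp
    then show ?thesis using Gibbs_entropy(2)[OF \<open>finite \<G>\<close> ac[OF p] qG] by simp
  qed
  have "canonical \<G> C c = arg_max (entropy_on \<G>) (feasible \<G> c)"
    by (simp add: canonical_def feasible_def)
  also have "\<dots> = q"
    unfolding arg_max_def
    by (rule some_equality[of "is_arg_max (entropy_on \<G>) (feasible \<G> c)", OF max unique])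
  finally show ?thesis .
qed

section \<open>Binomial probabilities at the mean\<close>

text \<open>The ratio of consecutive binomial probabilities, cleared of denominators.\<close>

lemma Bernstein_Suc:
  assumes "k < N"
  shows "real (Suc k) * (1 - x) * Bernstein N (Suc k) x = real (N - k) * x * Bernstein N k x"
proof -
  have "Suc k * (N choose Suc k) = (N - k) * (N choose k)"
    using binomial_absorption[of k N] binomial_absorb_comp[of N k] by simp
  then have "real (Suc k) * real (N choose Suc k) = real (N - k) * real (N choose k)"
    by (metis of_nat_mult)
  moreover have "(1 - x) ^ (N - k) = (1 - x) * (1 - x) ^ (N - Suc k)"
    using assms by (metis Suc_diff_Suc power_Suc)
  ultimately show ?thesis
    by (simp add: Bernstein_def mult_ac del: of_nat_Suc)
qed

lemma Bernstein_mode: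
  assumes "0 < l" "l < N" "k \<le> N"
  shows "Bernstein N k (l / N) \<le> Bernstein N l (l / N)"
proof -
  define x where "x = real l / real N"
  have x: "0 < x" "x < 1" "real N * x = l" using assms by (auto simp: x_def)
  have step: "(real (Suc k) * (1 - x)) * Bernstein N (Suc k) x = (real (N - k) * x) * Bernstein N k x"
    if "k < N" for k using Bernstein_Suc[OF that, of x] by simp
  \<comment> \<open>The sign of this difference decides whether the probabilities rise or fall from
    \<open>k\<close> to \<open>Suc k\<close>. It is at least \<open>x > 0\<close> for
    \<open>k < l\<close> and at most \<open>x - 1 < 0\<close> for \<open>k \<ge> l\<close>, so the
    peak is at \<open>l\<close>.\<close>
  have diff: "real (N - k) * x - real (Suc k) * (1 - x) = real l - real k - 1 + x" if "k < N" for k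
    using that x(3) by (simp add: of_nat_diff algebra_simps)
  have up: "Bernstein N k x \<le> Bernstein N (Suc k) x" if "k < l" for k
  proof -
    have "k < N" using that assms by simp
    have "real (Suc k) * (1 - x) \<le> real (N - k) * x" using diff[OF \<open>k < N\<close>] that x by linarith
    then have "(real (Suc k) * (1 - x)) * Bernstein N k x \<le> (real (Suc k) * (1 - x)) * Bernstein N (Suc k) x"
      unfolding step[OF \<open>k < N\<close>] by (rule mult_right_mono) (use x in \<open>simp add: Bernstein_nonneg\<close>)
    then show ?thesis by (rule mult_left_le_imp_le) (use x in simp)
  qed
  have down: "Bernstein N (Suc k) x \<le> Bernstein N k x" if "l \<le> k" "k < N" for k
  proof -
    have "real (N - k) * x \<le> real (Suc k) * (1 - x)" using diff[OF \<open>k < N\<close>] that x by linarith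
    then have "(real (Suc k) * (1 - x)) * Bernstein N (Suc k) x \<le> (real (Suc k) * (1 - x)) * Bernstein N k x"
      unfolding step[OF \<open>k < N\<close>] by (rule mult_right_mono) (use x in \<open>simp add: Bernstein_nonneg\<close>)
    then show ?thesis by (rule mult_left_le_imp_le) (use x in simp)
  qed
  have "Bernstein N k x \<le> Bernstein N l x"
  proof (cases "k \<le> l")
    case True
    then show ?thesis by (induction rule: inc_induct) (auto intro: order_trans up)
  next
    case False
    then have "l \<le> k" by simp
    then show ?thesis using assms(3)
      by (induction rule: dec_induct) (auto intro: order_trans[OF down])
  qed
  then show ?thesis by (simp add: x_def)
qed

text \<open>There are \<open>N + 1\<close> probabilities with sum 1, so the largest is at least
  their average.\<close>

lemma Bernstein_at_mean_bounds:
  assumes "l \<le> N"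
  shows "1 / (real N + 1) \<le> Bernstein N l (l / N)" and "Bernstein N l (l / N) \<le> 1"
proof -
  define x where "x = real l / real N"
  have x: "0 \<le> x" "x \<le> 1" using assms by (auto simp: x_def divide_le_eq_1)
  show "Bernstein N l (l / N) \<le> 1"
    using member_le_sum[of l "{..N}" "\<lambda>k. Bernstein N k x"] assms x Bernstein_nonneg
    by (auto simp: x_def)
  show "1 / (real N + 1) \<le> Bernstein N l (l / N)"
  proof (cases "0 < l \<and> l < N")
    case True
    have "1 = (\<Sum>k\<le>N. Bernstein N k x)" by simp
    also have "\<dots> \<le> (\<Sum>k\<le>N. Bernstein N l x)"
      using True by (intro sum_mono) (simp add: Bernstein_mode x_def)
    finally show ?thesis by (simp add: x_def field_simps)
  next
    case False
    \<comment> \<open>Here \<open>l = 0\<close> or \<open>l = N\<close>, and the distribution is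
      concentrated at \<open>l\<close>; the vanishing base has exponent 0 and
      \<open>0 ^ 0 = 1\<close>. The case \<open>N = 0\<close> falls under
      \<open>l = 0\<close>.\<close>
    then have "Bernstein N l (l / N) = 1" using assms by (cases "l = 0") (auto simp: Bernstein_def)
    then show ?thesis by simp
  qed
qed

section \<open>The canonical ensemble and the relative entropy\<close>

text \<open>
  All that is used about the graphs is that the number of links \<open>K\<close> takes each value \<open>k\<close>
  exactly \<open>N choose k\<close> times.
\<close>

locale binomially_graded =
  fixes \<G> :: "'g set" and K :: "'g \<Rightarrow> nat" and N l :: nat
  assumes finite_carrier: "finite \<G>"
    and grade_le: "G \<in> \<G> \<Longrightarrow> K G \<le> N"
    and card_grade: "k \<le> N \<Longrightarrow> card {G \<in> \<G>. K G = k} = N choose k"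
    and l_le: "l \<le> N"
begin

definition link_prob :: real where "link_prob = real l / real N"

text \<open>The probability of one particular graph with \<open>k\<close> links, hence without a
  binomial coefficient.\<close>

definition weight :: "nat \<Rightarrow> real" where "weight k = link_prob ^ k * (1 - link_prob) ^ (N - k)"

definition link_ensemble :: "'g pmf" where
  "link_ensemble = embed_pmf (\<lambda>G. if G \<in> \<G> then weight (K G) else 0)"

lemma link_prob_range: "0 \<le> link_prob" "link_prob \<le> 1" and N_times_link_prob: "real N * link_prob = real l"
  using l_le by (auto simp: link_prob_def divide_le_eq_1)

lemma weight_nonneg: "0 \<le> weight k"
  using link_prob_range by (simp add: weight_def)

text \<open>Turns sums over graphs into binomial sums, so that the total mass and the mean of
  \<open>link_ensemble\<close> come from the Bernstein identities.\<close>

lemma sum_grade: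
  fixes f :: "nat \<Rightarrow> real"
  shows "(\<Sum>G\<in>\<G>. f (K G)) = (\<Sum>k\<le>N. real (N choose k) * f k)"
proof -
  have "(\<Sum>G\<in>\<G>. f (K G)) = (\<Sum>k\<le>N. \<Sum>G | G \<in> \<G> \<and> K G = k. f (K G))"
    by (rule sum.group[symmetric]) (use finite_carrier grade_le in auto)
  also have "\<dots> = (\<Sum>k\<le>N. real (N choose k) * f k)"
    by (rule sum.cong) (auto simp: card_grade)
  finally show ?thesis .
qed

lemma pmf_link_ensemble: "pmf link_ensemble G = (if G \<in> \<G> then weight (K G) else 0)"
  unfolding link_ensemble_def
proof (rule pmf_embed_pmf)
  have "(\<Sum>G\<in>\<G>. weight (K G)) = 1"
    using sum_Bernstein[of N link_prob] sum_grade[of weight] by (simp add: Bernstein_def weight_def mult.assoc)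
  then show "(\<integral>\<^sup>+ G. ennreal (if G \<in> \<G> then weight (K G) else 0) \<partial>count_space UNIV) = 1"
    by (subst nn_integral_count_space'[of \<G>])
       (auto simp: finite_carrier weight_nonneg sum_ennreal)
qed (simp add: weight_nonneg)

lemma sum_K_link_ensemble: "(\<Sum>G\<in>\<G>. pmf link_ensemble G * real (K G)) = real l"
proof -
  have "(\<Sum>G\<in>\<G>. pmf link_ensemble G * real (K G)) = (\<Sum>G\<in>\<G>. weight (K G) * real (K G))"
    by (simp add: pmf_link_ensemble)
  also have "\<dots> = (\<Sum>k\<le>N. real k * Bernstein N k link_prob)"
    by (subst sum_grade[of "\<lambda>k. weight k * real k"]) (simp add: Bernstein_def weight_def mult_ac)
  finally show ?thesis by (simp add: N_times_link_prob)
qed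

lemma ln_weight: "k \<le> N \<Longrightarrow> ln (weight k) = real k * ln link_prob + real (N - k) * ln (1 - link_prob)"
  \<comment> \<open>For \<open>link_prob = 0\<close> and \<open>link_prob = 1\<close> this relies on \<open>ln 0 = 0\<close>.\<close>
  using link_prob_range
  by (cases "link_prob = 0"; cases "link_prob = 1") (auto simp: weight_def ln_mult ln_realpow power_0_left)

text \<open>A mean at an end of the range \<open>0..N\<close> leaves no mass elsewhere: the distance
  to that end is nonnegative with expectation 0.\<close>

lemma extreme_grade:
  assumes "set_pmf p \<subseteq> \<G>" and mean: "(\<Sum>G\<in>\<G>. pmf p G * real (K G)) = real l"
    and "G \<in> set_pmf p" and "l = 0 \<or> l = N"
  shows "K G = l"
proof -
  have G: "G \<in> \<G>" "pmf p G \<noteq> 0" using assms by (auto simp: set_pmf_iff)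
  have total: "(\<Sum>G\<in>\<G>. pmf p G) = 1" by (simp add: assms finite_carrier sum_pmf_eq_1)
  show ?thesis
  proof (cases "l = 0")
    case True
    then have "(\<Sum>G\<in>\<G>. pmf p G * real (K G)) = 0" using mean by simp
    then have "\<forall>G\<in>\<G>. pmf p G * real (K G) = 0"
      by (subst (asm) sum_nonneg_eq_0_iff) (auto simp: finite_carrier)
    then show ?thesis using G True by auto
  next
    case False
    then have "l = N" using assms by simp
    have "(\<Sum>G\<in>\<G>. pmf p G * (real N - real (K G))) = 0"
      using mean total \<open>l = N\<close>
      by (simp add: right_diff_distrib sum_subtractf flip: sum_distrib_right)
    then have "\<forall>G\<in>\<G>. pmf p G * (real N - real (K G)) = 0"
      using grade_le by (subst (asm) sum_nonneg_eq_0_iff) (auto simp: finite_carrier)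
    then show ?thesis using G \<open>l = N\<close> by auto
  qed
qed

lemma weight_l_pos: "0 < weight l"
  using l_le by (cases "l = 0 \<or> l = N") (auto simp: weight_def link_prob_def)

lemma canonical_eq: "canonical \<G> (\<lambda>G. real (K G)) (real l) = link_ensemble"
proof (rule canonical_eqI)
  show "finite \<G>" by (rule finite_carrier)
  show "set_pmf link_ensemble \<subseteq> \<G> \<and> (\<Sum>G\<in>\<G>. pmf link_ensemble G *\<^sub>R real (K G)) = real l"
    using sum_K_link_ensemble by (auto simp: set_pmf_iff pmf_link_ensemble split: if_splits)
next
  fix p :: "'g pmf"
  assume "set_pmf p \<subseteq> \<G> \<and> (\<Sum>G\<in>\<G>. pmf p G *\<^sub>R real (K G)) = real l"
  then have p: "set_pmf p \<subseteq> \<G>" and mean: "(\<Sum>G\<in>\<G>. pmf p G * real (K G)) = real l" by auto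
  show "set_pmf p \<subseteq> set_pmf link_ensemble"
  proof
    fix G assume G: "G \<in> set_pmf p"
    have "weight (K G) > 0"
    \<comment> \<open>At an extreme \<open>l\<close>, \<open>link_prob\<close> is 0 or 1 and
      \<open>weight\<close> vanishes off the grade \<open>l\<close>, so the constraint itself must
      confine \<open>p\<close> to that grade. Otherwise all weights are positive.\<close>
    proof (cases "l = 0 \<or> l = N")
      case True
      then show ?thesis using extreme_grade[OF p mean G] weight_l_pos by simp
    next
      case False
      then show ?thesis using l_le by (simp add: weight_def link_prob_def)
    qed
    then show "G \<in> set_pmf link_ensemble" using p G by (auto simp: set_pmf_iff pmf_link_ensemble)
  qed
  \<comment> \<open>The log-density is affine in \<open>K G\<close>, so its expectation depends on
    \<open>p\<close> only through the prescribed mean and the total mass.\<close>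
  have "(\<Sum>G\<in>\<G>. pmf p G * ln (pmf link_ensemble G))
      = (\<Sum>G\<in>\<G>. pmf p G * real (K G) * (ln link_prob - ln (1 - link_prob))
          + pmf p G * (real N * ln (1 - link_prob)))"
    by (rule sum.cong) (auto simp: pmf_link_ensemble ln_weight grade_le of_nat_diff algebra_simps)
  also have "\<dots> = real l * (ln link_prob - ln (1 - link_prob)) + real N * ln (1 - link_prob)"
    using p by (simp add: sum.distrib mean sum_pmf_eq_1 finite_carrier flip: sum_distrib_right)
  finally show "(\<Sum>G\<in>\<G>. pmf p G * ln (pmf link_ensemble G))
      = real l * (ln link_prob - ln (1 - link_prob)) + real N * ln (1 - link_prob)" .
qed

text \<open>Both ensembles are constant on the \<open>N choose l\<close> graphs of grade
  \<open>l\<close>, so these contribute equal terms. The canonical probability of the whole grade is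
  the Bernstein value.\<close>

lemma relative_entropy_eq:
  "relative_entropy \<G> (microcanonical \<G> (\<lambda>G. real (K G)) (real l))
     (canonical \<G> (\<lambda>G. real (K G)) (real l)) = ereal (- ln (Bernstein N l (l / N)))"
proof -
  define A where "A = {G \<in> \<G>. K G = l}"
  have card_A: "card A = N choose l" by (simp add: A_def card_grade l_le)
  have "A \<noteq> {}" using card_A zero_less_binomial[OF l_le] by force
  then have A: "finite A" "A \<noteq> {}" "A \<subseteq> \<G>" using finite_carrier by (auto simp: A_def)
  have mic: "microcanonical \<G> (\<lambda>G. real (K G)) (real l) = pmf_of_set A"
    by (simp add: microcanonical_def A_def)
  have "relative_entropy \<G> (pmf_of_set A) link_ensemble
      = (\<Sum>G\<in>A. if pmf (pmf_of_set A) G = 0 then 0 else if pmf link_ensemble G = 0 then \<infinity>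
           else ereal (pmf (pmf_of_set A) G * ln (pmf (pmf_of_set A) G / pmf link_ensemble G)))"
    unfolding relative_entropy_def
    by (rule sum.mono_neutral_right) (use A finite_carrier in auto)
  \<comment> \<open>The infinite branch is excluded by \<open>weight_l_pos\<close>.\<close>
  also have "\<dots> = (\<Sum>G\<in>A. ereal (1 / card A * ln (1 / card A / weight l)))"
    using weight_l_pos A by (intro sum.cong) (auto simp: pmf_link_ensemble, auto simp: A_def)
  also have "\<dots> = ereal (ln (1 / (card A * weight l)))"
    using A by (simp add: card_gt_0_iff)
  also have "1 / (card A * weight l) = inverse (Bernstein N l (l / N))"
    by (simp add: card_A Bernstein_def weight_def link_prob_def inverse_eq_divide mult_ac)
  finally show ?thesis by (simp add: mic canonical_eq ln_inverse)
qed

lemma relative_entropy_bounds: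
  "\<exists>s. relative_entropy \<G> (microcanonical \<G> (\<lambda>G. real (K G)) (real l))
     (canonical \<G> (\<lambda>G. real (K G)) (real l)) = ereal s \<and> 0 \<le> s \<and> s \<le> ln (real N + 1)"
proof -
  let ?b = "Bernstein N l (l / N)"
  have b: "1 / (real N + 1) \<le> ?b" "?b \<le> 1" using Bernstein_at_mean_bounds[OF l_le] by auto
  then have "0 < ?b" by (smt (verit) divide_pos_pos of_nat_0_le_iff)
  moreover have "ln (1 / (real N + 1)) \<le> ln ?b" using b by (intro ln_mono) auto
  ultimately have "0 \<le> - ln ?b \<and> - ln ?b \<le> ln (real N + 1)"
    using b by (simp add: ln_div)
  then show ?thesis using relative_entropy_eq by blast
qed

end

section \<open>Counting bipartite graphs by links\<close>

text \<open>Only arcs from \<open>A\<close> to \<open>B\<close> enter the double sum, so each link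
  counts once although it is stored as two arcs.\<close>

lemma total_links_eq_card:
  assumes "finite A" "finite B"
  shows "total_links A B G = real (card (parcs G \<inter> A \<times> B))"
proof -
  have "total_links A B G = (\<Sum>e\<in>A \<times> B. if e \<in> parcs G then 1 else 0)"
    by (simp add: total_links_def adj_entry_def sum.cartesian_product case_prod_unfold)
  also have "\<dots> = real (card (parcs G \<inter> A \<times> B))"
    using assms by (simp add: Int_commute flip: sum.inter_restrict)
  finally show ?thesis .
qed

text \<open>Irreflexivity follows from disjointness of the layers, and finiteness of the arc set
  from finiteness of the layers.\<close>

lemma bipartite_graph_iff:
  assumes "finite A" "finite B" "A \<inter> B = {}"
  shows "bipartite_graph A B G \<longleftrightarrow>
    pverts G = A \<union> B \<and> sym (parcs G) \<and> parcs G \<subseteq> A \<times> B \<union> B \<times> A"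
proof
  assume G: "bipartite_graph A B G"
  then interpret pair_graph G by (simp add: bipartite_graph_def)
  have "sym (parcs G)" using pair_sym_arcs by (simp add: symmetric_def)
  moreover have "parcs G \<subseteq> A \<times> B \<union> B \<times> A"
    using G in_arcsD1 in_arcsD2 by (fastforce simp: bipartite_graph_def adj_entry_def)
  ultimately show "pverts G = A \<union> B \<and> sym (parcs G) \<and> parcs G \<subseteq> A \<times> B \<union> B \<times> A"
    using G by (simp add: bipartite_graph_def)
next
  assume G: "pverts G = A \<union> B \<and> sym (parcs G) \<and> parcs G \<subseteq> A \<times> B \<union> B \<times> A"
  have "finite (parcs G)" using G assms by (meson finite_SigmaI finite_UnI finite_subset)
  then have "pair_graph G"
    using G assms by unfold_locales (auto simp: symmetric_def)
  then show "bipartite_graph A B G"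
    using G assms by (auto simp: bipartite_graph_def adj_entry_def)
qed

text \<open>Each link has exactly one orientation from \<open>A\<close> to \<open>B\<close>;
  symmetrising these oriented arcs recovers the graph.\<close>

lemma bij_betw_bipartite_graphs:
  assumes "finite A" "finite B" "A \<inter> B = {}"
  shows "bij_betw (\<lambda>G. parcs G \<inter> A \<times> B) (bipartite_graphs A B) (Pow (A \<times> B))"
proof (rule bij_betw_byWitness[where f' = "\<lambda>E. \<lparr>pverts = A \<union> B, parcs = E \<union> E\<inverse>\<rparr>"])
  let ?graph = "\<lambda>E. \<lparr>pverts = A \<union> B, parcs = E \<union> E\<inverse>\<rparr>"
  show "\<forall>G\<in>bipartite_graphs A B. ?graph (parcs G \<inter> A \<times> B) = G"
  proof
    fix G assume "G \<in> bipartite_graphs A B"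
    then have G: "pverts G = A \<union> B" "sym (parcs G)" "parcs G \<subseteq> A \<times> B \<union> B \<times> A"
      using assms by (auto simp: bipartite_graphs_def bipartite_graph_iff)
    have "parcs G \<inter> A \<times> B \<union> (parcs G \<inter> A \<times> B)\<inverse> = parcs G"
      using G(2,3) by (auto dest: symD)
    then show "?graph (parcs G \<inter> A \<times> B) = G" using G(1) by simp
  qed
  show "\<forall>E\<in>Pow (A \<times> B). parcs (?graph E) \<inter> A \<times> B = E" using assms by auto
  show "(\<lambda>G. parcs G \<inter> A \<times> B) ` bipartite_graphs A B \<subseteq> Pow (A \<times> B)" by auto
  show "?graph ` Pow (A \<times> B) \<subseteq> bipartite_graphs A B"
    using assms by (auto simp: bipartite_graphs_def bipartite_graph_iff sym_Un_converse)
qed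

lemma binomially_graded_bipartite_graphs:
  assumes "finite A" "finite B" "A \<inter> B = {}" and l: "l \<le> card A * card B"
  shows "binomially_graded (bipartite_graphs A B) (\<lambda>G. card (parcs G \<inter> A \<times> B)) (card A * card B) l"
proof
  note bij = bij_betw_bipartite_graphs[OF assms(1-3)]
  show "finite (bipartite_graphs A B)"
    using bij_betw_finite[OF bij] assms by simp
  show "card (parcs G \<inter> A \<times> B) \<le> card A * card B" for G
    using assms card_mono[of "A \<times> B" "parcs G \<inter> A \<times> B"] by (simp add: card_cartesian_product)
  fix k
  let ?f = "\<lambda>G. parcs G \<inter> A \<times> B"
  have "?f ` {G \<in> bipartite_graphs A B. card (?f G) = k} = {E \<in> ?f ` bipartite_graphs A B. card E = k}"
    by auto
  also have "?f ` bipartite_graphs A B = Pow (A \<times> B)"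
    using bij by (rule bij_betw_imp_surj_on)
  finally have "bij_betw ?f {G \<in> bipartite_graphs A B. card (?f G) = k} {E \<in> Pow (A \<times> B). card E = k}"
    by (intro bij_betw_subset[OF bij]) auto
  then have "card {G \<in> bipartite_graphs A B. card (?f G) = k} = card {E. E \<subseteq> A \<times> B \<and> card E = k}"
    by (simp add: bij_betw_same_card)
  also have "\<dots> = card A * card B choose k"
    using assms by (simp add: n_subsets card_cartesian_product)
  finally show "card {G \<in> bipartite_graphs A B. card (?f G) = k} = card A * card B choose k" .
qed (rule l)

section \<open>The limit per node\<close>

theorem theorem1p7:
  fixes n1 n2 :: "nat \<Rightarrow> nat"
    and \<Lambda>1 \<Lambda>2 :: "nat \<Rightarrow> 'a set"
    and Lstar :: "nat \<Rightarrow> real"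
  assumes "\<And>n. n1 n + n2 n = n"
    and "\<And>n. finite (\<Lambda>1 n)" and "\<And>n. finite (\<Lambda>2 n)"
    and "\<And>n. \<Lambda>1 n \<inter> \<Lambda>2 n = {}"
    and "\<And>n. card (\<Lambda>1 n) = n1 n" and "\<And>n. card (\<Lambda>2 n) = n2 n"
    and "\<And>n. \<exists>G \<in> bipartite_graphs (\<Lambda>1 n) (\<Lambda>2 n). total_links (\<Lambda>1 n) (\<Lambda>2 n) G = Lstar n"
  shows "(\<lambda>n. relative_entropy (bipartite_graphs (\<Lambda>1 n) (\<Lambda>2 n))
              (microcanonical (bipartite_graphs (\<Lambda>1 n) (\<Lambda>2 n)) (total_links (\<Lambda>1 n) (\<Lambda>2 n)) (Lstar n))
              (canonical (bipartite_graphs (\<Lambda>1 n) (\<Lambda>2 n)) (total_links (\<Lambda>1 n) (\<Lambda>2 n)) (Lstar n))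
            / ereal (real (n1 n + n2 n))) \<longlonglongrightarrow> 0"
proof -
  let ?S = "\<lambda>n. relative_entropy (bipartite_graphs (\<Lambda>1 n) (\<Lambda>2 n))
    (microcanonical (bipartite_graphs (\<Lambda>1 n) (\<Lambda>2 n)) (total_links (\<Lambda>1 n) (\<Lambda>2 n)) (Lstar n))
    (canonical (bipartite_graphs (\<Lambda>1 n) (\<Lambda>2 n)) (total_links (\<Lambda>1 n) (\<Lambda>2 n)) (Lstar n))"
  have "\<exists>s. ?S n = ereal s \<and> 0 \<le> s \<and> s \<le> ln ((real n)\<^sup>2 + 1)" for n
  proof -
    let ?A = "\<Lambda>1 n" and ?B = "\<Lambda>2 n"
    let ?K = "\<lambda>G :: 'a pair_pre_digraph. card (parcs G \<inter> ?A \<times> ?B)"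
    have tl: "total_links ?A ?B = (\<lambda>G. real (?K G))"
      using assms(2,3) by (auto simp: total_links_eq_card)
    \<comment> \<open>Being realised by a graph makes \<open>Lstar n\<close> a natural number
      between 0 and the number of possible links.\<close>
    obtain G where "real (?K G) = Lstar n" using assms(7)[of n] tl by auto
    moreover have "?K G \<le> card ?A * card ?B"
      using assms(2,3) card_mono[of "?A \<times> ?B" "parcs G \<inter> ?A \<times> ?B"]
      by (simp add: card_cartesian_product)
    ultimately obtain l where l: "Lstar n = real l" "l \<le> card ?A * card ?B" by metis
    interpret binomially_graded "bipartite_graphs ?A ?B" ?K "card ?A * card ?B" l
      using assms l by (intro binomially_graded_bipartite_graphs)
    obtain s where s: "?S n = ereal s" "0 \<le> s" "s \<le> ln (real (card ?A * card ?B) + 1)"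
      using relative_entropy_bounds by (auto simp: tl l)
    have "card ?A * card ?B \<le> n * n"
      using assms(1)[of n] assms(5,6) by (intro mult_mono) auto
    then have "real (card ?A * card ?B) \<le> (real n)\<^sup>2"
      unfolding power2_eq_square by (metis of_nat_le_iff of_nat_mult)
    then have "ln (real (card ?A * card ?B) + 1) \<le> ln ((real n)\<^sup>2 + 1)"
      by (intro ln_mono) (auto intro: add_nonneg_pos)
    with s show ?thesis by force
  qed
  then obtain s where s: "\<And>n. ?S n = ereal (s n)" "\<And>n. 0 \<le> s n" "\<And>n. s n \<le> ln ((real n)\<^sup>2 + 1)"
    by metis
  have "(\<lambda>n. s n / real n) \<longlonglongrightarrow> 0"
  proof (rule tendsto_sandwich[OF _ _ tendsto_const])
    show "(\<lambda>n. ln ((real n)\<^sup>2 + 1) / real n) \<longlonglongrightarrow> 0" by real_asymp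
    show "\<forall>\<^sub>F n in sequentially. 0 \<le> s n / real n" by (simp add: s)
    show "\<forall>\<^sub>F n in sequentially. s n / real n \<le> ln ((real n)\<^sup>2 + 1) / real n"
      by (intro always_eventually allI divide_right_mono s) simp
  qed
  then have "(\<lambda>n. ereal (s n / real n)) \<longlonglongrightarrow> 0"
    by (simp add: zero_ereal_def)
  \<comment> \<open>Division by 0 follows different conventions in \<open>real\<close> and
    \<open>ereal\<close>, so the quotients are compared only for \<open>n > 0\<close>.\<close>
  moreover have "\<forall>\<^sub>F n in sequentially. ereal (s n / real n) = ?S n / ereal (real (n1 n + n2 n))"
    using eventually_gt_at_top[of 0] by eventually_elim (simp add: s assms(1))
  ultimately show ?thesis by (rule Lim_transform_eventually)
qed

end
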